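(* Let $\mathbf X\in\mathbb R^{n\times d}$, $\mathbf y\in\mathbb R^n$, $\sigma>0$, and let $h_\lambda:\mathbb R^d\to\mathbb R$ be $\sigma$-strongly convex. Suppose $0<\varepsilon<\varepsilon_0<1$, where $\varepsilon_0$ is a small positive constant, $0<\delta<1$, and $\mathbf P$ is drawn from an $(\varepsilon,\delta)$ oblivious $\ell^2$-subspace embedding over $\tilde n\times n$ matrices; put $\tilde{\mathbf X}=\mathbf P\mathbf X$. Let $\boldsymbol\beta^*$ be any critical point of $f(\boldsymbol\beta)=\frac12\|\mathbf y-\mathbf X\boldsymbol\beta\|_2^2+h_\lambda(\boldsymbol\beta)$ and $\tilde{\boldsymbol\beta}^*$ any critical point of $\tilde f(\boldsymbol\beta)=\frac12\boldsymbol\beta^\top\tilde{\mathbf X}^\top\tilde{\mathbf X}\boldsymbol\beta-\langle\mathbf y,\mathbf X\boldsymbol\beta\rangle+h_\lambda(\boldsymbol\beta)$. Then with probability at least $1-\delta$, $$\|\tilde{\boldsymbol\beta}^*-\boldsymbol\beta^*\|_2^2\le\frac{\varepsilon^2}{4\sigma(1-\varepsilon)}\,\|\boldsymbol\beta^*\|_{\mathbf X}^2,$$ and, when $\|\tilde{\boldsymbol\beta}^*-\boldsymbol\beta^*\|_{\mathbf X}\neq0$, $$\|\tilde{\boldsymbol\beta}^*-\boldsymbol\beta^*\|_{\mathbf X}\le\frac{\varepsilon}{1-\varepsilon}\|\boldsymbol\beta^*\|_{\mathbf X}-\frac{\sigma\|\tilde{\boldsymbol\beta}^*-\boldsymbol\beta^*\|_2^2}{(1-\varepsilon)\|\tilde{\boldsymbol\beta}^*-\boldsymbol\beta^*\|_{\mathbf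 X}}.$$
   Context: Notation: $\|\mathbf u\|_{\mathbf X}=\|\mathbf X\mathbf u\|_2$. A differentiable function $h:\mathbb R^d\to\mathbb R$ is $\sigma$-strongly convex ($\sigma>0$) if $h(\mathbf y)\ge h(\mathbf x)+\langle\nabla h(\mathbf x),\mathbf y-\mathbf x\rangle+\frac\sigma2\|\mathbf y-\mathbf x\|_2^2$ for all $\mathbf x,\mathbf y\in\mathbb R^d$. A critical point of a function is a point at which $\mathbf 0$ belongs to its limiting subdifferential; for the functions here (convex and differentiable) this means the gradient vanishes. A distribution $\mathcal P$ over $\tilde n\times n$ matrices (where $\tilde n$ is a function of $n,d,\varepsilon,\delta$) is an $(\varepsilon,\delta)$ oblivious $\ell^2$-subspace embedding if for any fixed $n\times d$ matrix $\mathbf X$, with probability at least $1-\delta$ a matrix $\mathbf P\sim\mathcal P$ satisfies $(1-\varepsilon)\|\mathbf X\boldsymbol\beta\|_2^2\le\|\mathbf P\mathbf X\boldsymbol\beta\|_2^2\le(1+\varepsilon)\|\mathbf X\boldsymbol\beta\|_2^2$ for all $\boldsymbol\beta\in\mathbb R^d$. *)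

theory Defs
  imports "HOL-Probability.Probability"
begin

definition gradient :: "('a::real_inner \<Rightarrow> real) \<Rightarrow> 'a \<Rightarrow> 'a" where
  "gradient f x = (THE D. GDERIV f x :> D)"

definition strongly_convex :: "real \<Rightarrow> ('a::real_inner \<Rightarrow> real) \<Rightarrow> bool" where
  "strongly_convex \<sigma> h \<longleftrightarrow>
     0 < \<sigma> \<and> (\<forall>x. h differentiable (at x)) \<and>
     (\<forall>x y. h y \<ge> h x + gradient h x \<bullet> (y - x) + \<sigma> / 2 * (norm (y - x))\<^sup>2)"

text \<open>
  Regular (Frechet) subdifferential: f y \<ge> f x + v \<bullet> (y - x) + o(norm (y - x)) as y tends to x.
  The limiting (Mordukhovich) subdifferential is its closure along f-attentive sequences.
\<close>

definition regular_subdifferential :: "('a::real_inner \<Rightarrow> real) \<Rightarrow> 'a \<Rightarrow> 'a set" where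
  "regular_subdifferential f x =
     {v. 0 \<le> Liminf (at x) (\<lambda>y. ereal ((f y - f x - v \<bullet> (y - x)) / norm (y - x)))}"

definition limiting_subdifferential :: "('a::real_inner \<Rightarrow> real) \<Rightarrow> 'a \<Rightarrow> 'a set" where
  "limiting_subdifferential f x =
     {v. \<exists>xs vs. xs \<longlonglongrightarrow> x \<and> (\<lambda>k. f (xs k)) \<longlonglongrightarrow> f x \<and>
           (\<forall>k. vs k \<in> regular_subdifferential f (xs k)) \<and> vs \<longlonglongrightarrow> v}"

definition critical_point :: "('a::real_inner \<Rightarrow> real) \<Rightarrow> 'a \<Rightarrow> bool" where
  "critical_point f x \<longleftrightarrow> 0 \<in> limiting_subdifferential f x"

lemma gradient_eq:
  fixes f :: "'a::real_inner \<Rightarrow> real"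
  assumes "GDERIV f x :> D"
  shows "gradient f x = D"
  unfolding gradient_def
proof (rule the_equality)
  fix E assume "GDERIV f x :> E"
  then have "(\<lambda>h. h \<bullet> E) = (\<lambda>h. h \<bullet> D)"
    using assms unfolding gderiv_def by (rule has_derivative_unique)
  then have "(E - D) \<bullet> E = (E - D) \<bullet> D" by metis
  then have "(E - D) \<bullet> (E - D) = 0" by (simp add: inner_diff_right)
  then show "E = D" by simp
qed (rule assms)

lemma gderiv_gradient:
  fixes f :: "'a::euclidean_space \<Rightarrow> real"
  assumes "f differentiable (at x)"
  shows "GDERIV f x :> gradient f x"
proof -
  obtain F where F: "(f has_derivative F) (at x)"
    using assms unfolding differentiable_def by blast
  then have lin: "linear F" by (simp add: has_derivative_bounded_linear bounded_linear.linear)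
  have "F = (\<lambda>h. h \<bullet> (\<Sum>b\<in>Basis. F b *\<^sub>R b))"
  proof
    fix h
    have "F h = F (\<Sum>b\<in>Basis. (h \<bullet> b) *\<^sub>R b)" by (simp add: euclidean_representation)
    also have "\<dots> = (\<Sum>b\<in>Basis. (h \<bullet> b) * F b)"
      using lin by (simp add: linear_sum linear_cmul)
    finally show "F h = h \<bullet> (\<Sum>b\<in>Basis. F b *\<^sub>R b)"
      by (simp add: inner_sum_right mult.commute)
  qed
  with F have "GDERIV f x :> (\<Sum>b\<in>Basis. F b *\<^sub>R b)"
    unfolding gderiv_def by simp
  then show ?thesis using gradient_eq by fastforce
qed

lemma regular_subgradient_convex:
  fixes f :: "'a::euclidean_space \<Rightarrow> real"
  assumes cvx: "convex_on UNIV f" and v: "v \<in> regular_subdifferential f x"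
  shows "f x + v \<bullet> (y - x) \<le> f y"
proof (cases "y = x")
  case False
  then have n: "norm (y - x) > 0" by simp
  have "f x + v \<bullet> (y - x) - e * norm (y - x) \<le> f y" if e: "e > 0" for e
  proof -
    have "ereal (- e) < 0" using e by simp
    with v have "eventually (\<lambda>z. ereal (- e) < ereal ((f z - f x - v \<bullet> (z - x)) / norm (z - x))) (at x)"
      unfolding regular_subdifferential_def le_Liminf_iff by blast
    then obtain d where d: "d > 0" and
      D: "\<And>z. z \<noteq> x \<Longrightarrow> dist z x < d \<Longrightarrow> - e < (f z - f x - v \<bullet> (z - x)) / norm (z - x)"
      unfolding eventually_at by auto
    define t where "t = min 1 (d / (2 * norm (y - x)))"
    have t: "0 < t" "t \<le> 1" using d n by (auto simp: t_def)
    define z where "z = x + t *\<^sub>R (y - x)"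
    have zx: "z - x = t *\<^sub>R (y - x)" by (simp add: z_def)
    have nz: "norm (z - x) = t * norm (y - x)" using t zx by simp
    have "t * norm (y - x) \<le> d / (2 * norm (y - x)) * norm (y - x)"
      using n by (intro mult_right_mono) (auto simp: t_def)
    then have "dist z x < d" using n d nz by (simp add: dist_norm)
    moreover have "z \<noteq> x" using t n nz by force
    ultimately have "- e * norm (z - x) < f z - f x - v \<bullet> (z - x)"
      using D[of z] t n nz by (simp add: pos_less_divide_eq)
    then have 1: "- (t * (e * norm (y - x))) < f z - f x - t * (v \<bullet> (y - x))"
      unfolding nz zx using t by (simp add: mult.left_commute)
    have "z = (1 - t) *\<^sub>R x + t *\<^sub>R y" by (simp add: z_def algebra_simps)
    then have "f z \<le> (1 - t) * f x + t * f y"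
      using convex_onD[OF cvx, of t x y] t by simp
    with 1 have "t * (v \<bullet> (y - x) - e * norm (y - x)) \<le> t * (f y - f x)"
      by (simp add: algebra_simps)
    then show ?thesis using t by simp
  qed
  then have *: "f x + v \<bullet> (y - x) - f y \<le> e" if "e > 0" for e
    using n that by (metis (no_types, lifting) add.commute diff_le_eq divide_pos_pos
        less_numeral_extra(3) nonzero_eq_divide_eq)
  show ?thesis using field_le_epsilon[of "f x + v \<bullet> (y - x)" "f y"] *
    by (simp add: algebra_simps)
qed simp

lemma critical_point_iff_gradient:
  fixes f :: "'a::euclidean_space \<Rightarrow> real"
  assumes "convex_on UNIV f" and dif: "f differentiable (at x)"
  shows "critical_point f x \<longleftrightarrow> gradient f x = 0"
proof
  assume "critical_point f x"
  then obtain xs vs where lims: "xs \<longlonglongrightarrow> x" "(\<lambda>k. f (xs k)) \<longlonglongrightarrow> f x" "vs \<longlonglongrightarrow> 0"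
    and vs: "\<And>k. vs k \<in> regular_subdifferential f (xs k)"
    unfolding critical_point_def limiting_subdifferential_def by auto
  have "f x \<le> f y" for y
  proof -
    have "(\<lambda>k. f (xs k) + vs k \<bullet> (y - xs k)) \<longlonglongrightarrow> f x + 0 \<bullet> (y - x)"
      by (intro tendsto_intros lims)
    then have "f x + 0 \<bullet> (y - x) \<le> f y"
      by (rule LIMSEQ_le_const2) (use regular_subgradient_convex[OF assms(1) vs] in blast)
    then show ?thesis by simp
  qed
  then have "(\<lambda>h. h \<bullet> gradient f x) = (\<lambda>h. 0)"
    using gderiv_gradient[OF dif] unfolding gderiv_def
    by (intro has_derivative_local_min[of f _ x]) auto
  then have "gradient f x \<bullet> gradient f x = 0" by meson
  then show "gradient f x = 0" by simp
next
  assume "gradient f x = 0"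
  then have "(f has_derivative (\<lambda>h. 0)) (at x)"
    using gderiv_gradient[OF dif] by (simp add: gderiv_def)
  then have "((\<lambda>y. (f y - f x) / norm (y - x)) \<longlongrightarrow> 0) (at x)"
    by (simp add: has_derivative_at_within divide_inverse mult.commute)
  then have "((\<lambda>y. ereal ((f y - f x) / norm (y - x))) \<longlongrightarrow> 0) (at x)"
    by (simp add: zero_ereal_def)
  then have "Liminf (at x) (\<lambda>y. ereal ((f y - f x) / norm (y - x))) = 0"
    by (intro lim_imp_Liminf) auto
  then have "0 \<in> regular_subdifferential f x"
    by (simp add: regular_subdifferential_def)
  then show "critical_point f x"
    unfolding critical_point_def limiting_subdifferential_def
    by (intro CollectI exI[of _ "\<lambda>_. x"] exI[of _ "\<lambda>_. 0"]) simp
qed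

definition mat_seminorm :: "real^'d^'n \<Rightarrow> real^'d \<Rightarrow> real" where
  "mat_seminorm X u = norm (X *v u)"

text \<open>
  The dimension d of the embedded subspaces is the cardinality of the type 'd, passed as
  a type argument; the number of rows of the random matrix is the cardinality of 'm.
\<close>

definition oblivious_subspace_embedding ::
    "'d::finite itself \<Rightarrow> real \<Rightarrow> real \<Rightarrow> (real^'n::finite^'m::finite) measure \<Rightarrow> bool" where
  "oblivious_subspace_embedding _ \<epsilon> \<delta> \<P> \<longleftrightarrow>
     prob_space \<P> \<and> sets \<P> = sets borel \<and>
     (\<forall>X :: real^'d^'n.
        measure \<P> {P \<in> space \<P>. \<forall>\<beta>.
            (1 - \<epsilon>) * (norm (X *v \<beta>))\<^sup>2 \<le> (norm ((P ** X) *v \<beta>))\<^sup>2 \<and>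
            (norm ((P ** X) *v \<beta>))\<^sup>2 \<le> (1 + \<epsilon>) * (norm (X *v \<beta>))\<^sup>2}
          \<ge> 1 - \<delta>)"

definition least_squares_objective ::
    "real^'d^'n \<Rightarrow> real^'n \<Rightarrow> (real^'d \<Rightarrow> real) \<Rightarrow> real^'d \<Rightarrow> real" where
  "least_squares_objective X y h \<beta> = 1/2 * (norm (y - X *v \<beta>))\<^sup>2 + h \<beta>"

text \<open>Only the quadratic term is sketched; the linear term keeps the original X.\<close>

definition sketched_objective ::
    "real^'d^'m \<Rightarrow> real^'d^'n \<Rightarrow> real^'n \<Rightarrow> (real^'d \<Rightarrow> real) \<Rightarrow> real^'d \<Rightarrow> real" where
  "sketched_objective Xt X y h \<beta> =
     1/2 * (\<beta> \<bullet> ((transpose Xt ** Xt) *v \<beta>)) - y \<bullet> (X *v \<beta>) + h \<beta>"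

end

theory Submission
  imports Defs
begin

text \<open>
  Put D = \<beta>t - \<beta>s. Strong monotonicity of the gradient of h, evaluated at the two stationarity
  equations, gives \<sigma> |D|^2 + |Xt D|^2 \<le> <X \<beta>s, X D> - <Xt \<beta>s, Xt D>. On the embedding event the
  symmetric form <X u, X v> - <Xt u, Xt v> is bounded by \<epsilon> |X u| |X v| (polarisation), so
  \<sigma> |D|^2 + (1 - \<epsilon>) |X D|^2 \<le> \<epsilon> |X \<beta>s| |X D|; both bounds follow from this quadratic inequality.
  The event of the theorem must itself be measurable, as the measure of a non-measurable set is 0
  by convention. Critical points being global minimisers, the pairs (P, \<beta>t) violating the bounds
  form the intersection of a closed and an open set, hence a countable union of compact sets, and
  so is their projection to the first component.
\<close>

section \<open>Convexity and gradient monotonicity\<close>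

text \<open>Weight the affine minorants supporting \<open>f\<close> at the point \<open>w\<close> of
  the segment: the linear terms cancel, leaving exactly \<open>f w\<close>.\<close>

lemma convex_on_if_subgradients:
  fixes f :: "'a::real_inner \<Rightarrow> real"
  assumes sub: "\<And>x y. f x + g x \<bullet> (y - x) \<le> f y"
  shows "convex_on UNIV f"
proof (rule convex_onI)
  fix t :: real and x y :: 'a
  assume t: "0 < t" "t < 1"
  define w where "w = (1 - t) *\<^sub>R x + t *\<^sub>R y"
  have "(1 - t) * (f w + g w \<bullet> (x - w)) + t * (f w + g w \<bullet> (y - w)) \<le> (1 - t) * f x + t * f y"
    using t by (intro add_mono mult_left_mono sub) auto
  moreover have "(1 - t) * (f w + g w \<bullet> (x - w)) + t * (f w + g w \<bullet> (y - w))
      = f w + g w \<bullet> ((1 - t) *\<^sub>R x + t *\<^sub>R y - w)"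
    by (simp add: inner_diff_right inner_add_right algebra_simps)
  ultimately show "f ((1 - t) *\<^sub>R x + t *\<^sub>R y) \<le> (1 - t) * f x + t * f y"
    by (simp add: w_def)
qed simp

lemma gderiv_local_min_zero:
  fixes f :: "'a::euclidean_space \<Rightarrow> real"
  assumes "GDERIV f x :> D" and "\<And>y. f x \<le> f y"
  shows "D = 0"
proof -
  have "(\<lambda>h. h \<bullet> D) = (\<lambda>h. 0)"
    using assms unfolding gderiv_def by (intro has_derivative_local_min[of f _ x]) auto
  then show ?thesis by (metis inner_eq_zero_iff)
qed

lemma inner_vector_matrix_mult:
  fixes A :: "real^'d^'m"
  shows "v \<bullet> (u v* A) = u \<bullet> (A *v v)"
  by (metis dot_lmul_matrix inner_commute)

lemma strongly_convex_continuous_on: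
  "strongly_convex \<sigma> h \<Longrightarrow> continuous_on S h"
  by (meson strongly_convex_def differentiable_imp_continuous_within continuous_at_imp_continuous_on)

text \<open>Adding the strong convexity inequalities from \<open>u\<close> to \<open>v\<close> and
  from \<open>v\<close> to \<open>u\<close> cancels the function values, and the two terms with
  \<open>\<sigma> / 2\<close> add up.\<close>

lemma strongly_convex_gradient_monotone:
  assumes "strongly_convex \<sigma> h"
  shows "\<sigma> * (norm (v - u))\<^sup>2 \<le> (gradient h v - gradient h u) \<bullet> (v - u)"
proof -
  have "h v \<ge> h u + gradient h u \<bullet> (v - u) + \<sigma> / 2 * (norm (v - u))\<^sup>2"
    "h u \<ge> h v + gradient h v \<bullet> (u - v) + \<sigma> / 2 * (norm (u - v))\<^sup>2"
    using assms by (auto simp: strongly_convex_def)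
  then show ?thesis by (simp add: inner_diff_left inner_diff_right norm_minus_commute)
qed

section \<open>Critical points of the two objectives\<close>

text \<open>Both objectives have the form \<open>q\<close>. The stationarity equation serves the
  error estimate; the description by minimisers avoids \<open>gradient h\<close>, so that continuity
  of \<open>h\<close> suffices for measurability.\<close>

lemma
  fixes A :: "real^'d^'m" and h :: "real^'d \<Rightarrow> real" and l :: "real^'d" and c :: real
  assumes h: "strongly_convex \<sigma> h"
  defines "q \<equiv> \<lambda>\<beta>. 1/2 * (norm (A *v \<beta>))\<^sup>2 - l \<bullet> \<beta> + c + h \<beta>"
  shows critical_point_quadratic_plus_convex:
      "critical_point q \<beta> \<longleftrightarrow> gradient h \<beta> = l - transpose A *v (A *v \<beta>)"
    and critical_point_quadratic_plus_convex_iff_min: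
      "critical_point q \<beta> \<longleftrightarrow> (\<forall>z. q \<beta> \<le> q z)"
proof -
  define g where "g \<beta> = transpose A *v (A *v \<beta>) - l + gradient h \<beta>" for \<beta>
  have gderiv: "GDERIV q \<beta> :> g \<beta>" for \<beta>
  proof -
    have "h differentiable (at \<beta>)" using h by (simp add: strongly_convex_def)
    from gderiv_gradient[OF this]
    have [derivative_intros]: "(h has_derivative (\<lambda>k. k \<bullet> gradient h \<beta>)) (at \<beta>)"
      by (simp add: gderiv_def)
    have [derivative_intros]: "((*v) A has_derivative (*v) A) (at \<beta>)"
      by (intro bounded_linear_imp_has_derivative linear_conv_bounded_linear[THEN iffD1]) simp
    have q': "q = (\<lambda>\<beta>. 1/2 * ((A *v \<beta>) \<bullet> (A *v \<beta>)) - l \<bullet> \<beta> + c + h \<beta>)"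
      by (simp add: q_def power2_norm_eq_inner)
    show ?thesis unfolding gderiv_def q' g_def
      by (rule derivative_eq_intros refl ext | assumption)+
         (simp add: fun_eq_iff inner_add_right inner_diff_right inner_vector_matrix_mult inner_commute)
  qed
  \<comment> \<open>The quadratic part exceeds its linearisation at \<open>x\<close> by half of
    \<open>(norm (A *v z - A *v x))\<^sup>2\<close>, and \<open>h\<close> lies above its own by
    strong convexity.\<close>
  have sub: "q x + g x \<bullet> (z - x) \<le> q z" for x z
  proof -
    have "h z \<ge> h x + gradient h x \<bullet> (z - x) + \<sigma> / 2 * (norm (z - x))\<^sup>2" "\<sigma> > 0"
      using h by (auto simp: strongly_convex_def)
    moreover from \<open>\<sigma> > 0\<close> have "0 \<le> \<sigma> / 2 * (norm (z - x))\<^sup>2" by simp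
    ultimately have "h z \<ge> h x + gradient h x \<bullet> (z - x)" by linarith
    moreover have "0 \<le> (A *v z - A *v x) \<bullet> (A *v z - A *v x)" by simp
    moreover have "(transpose A *v (A *v x)) \<bullet> (z - x) = (A *v x) \<bullet> (A *v z - A *v x)"
      by (simp add: dot_lmul_matrix matrix_vector_mult_diff_distrib)
    ultimately show ?thesis
      unfolding q_def g_def
      by (simp add: power2_norm_eq_inner inner_diff_left inner_diff_right inner_add_left
          inner_add_right inner_commute)
  qed
  have crit: "critical_point q \<beta> \<longleftrightarrow> g \<beta> = 0"
    using critical_point_iff_gradient[OF convex_on_if_subgradients[OF sub], of \<beta>]
      gradient_eq[OF gderiv] gderiv[of \<beta>]
    unfolding gderiv_def differentiable_def by auto
  then show "critical_point q \<beta> \<longleftrightarrow> gradient h \<beta> = l - transpose A *v (A *v \<beta>)"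
    by (auto simp: g_def algebra_simps)
  show "critical_point q \<beta> \<longleftrightarrow> (\<forall>z. q \<beta> \<le> q z)"
    unfolding crit using gderiv_local_min_zero[OF gderiv] sub[of \<beta>] by (metis add_0_right inner_zero_left)
qed

lemma least_squares_objective_eq:
  "least_squares_objective X y h =
    (\<lambda>\<beta>. 1/2 * (norm (X *v \<beta>))\<^sup>2 - (transpose X *v y) \<bullet> \<beta> + 1/2 * (norm y)\<^sup>2 + h \<beta>)"
  by (rule ext) (simp add: least_squares_objective_def power2_norm_eq_inner inner_diff_left
      inner_diff_right inner_vector_matrix_mult inner_commute field_simps)

text \<open>The summand \<open>0\<close> is the constant \<open>c\<close> of the common form; the
  linear coefficient is the same as in the unsketched objective.\<close>

lemma sketched_objective_eq:
  "sketched_objective Xt X y h =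
    (\<lambda>\<beta>. 1/2 * (norm (Xt *v \<beta>))\<^sup>2 - (transpose X *v y) \<bullet> \<beta> + 0 + h \<beta>)"
  by (rule ext) (simp add: sketched_objective_def power2_norm_eq_inner
      inner_vector_matrix_mult inner_commute
      matrix_vector_mul_assoc[symmetric])

section \<open>The deterministic error estimate\<close>

lemma embedding_inner_bound:
  fixes f :: "'a::real_vector \<Rightarrow> 'b::real_inner" and g :: "'a \<Rightarrow> 'c::real_inner"
  assumes lin: "linear f" "linear g"
    and emb: "\<And>u. (1 - \<epsilon>) * (norm (f u))\<^sup>2 \<le> (norm (g u))\<^sup>2"
      "\<And>u. (norm (g u))\<^sup>2 \<le> (1 + \<epsilon>) * (norm (f u))\<^sup>2"
  shows "f u \<bullet> f v - g u \<bullet> g v \<le> \<epsilon> * norm (f u) * norm (f v)"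
proof (cases "f u = 0 \<or> f v = 0")
  case True
  \<comment> \<open>The upper embedding bound makes \<open>g\<close> vanish wherever
    \<open>f\<close> does.\<close>
  then have "g u = 0 \<or> g v = 0" using emb(2)[of u] emb(2)[of v] by auto
  with True show ?thesis by auto
next
  case False
  define a b where "a = norm (f u)" and "b = norm (f v)"
  have pos: "a > 0" "b > 0" using False by (auto simp: a_def b_def)
  \<comment> \<open>b u and a v have images of equal norm under f, so polarisation loses nothing.\<close>
  define p r where "p = b *\<^sub>R u + a *\<^sub>R v" and "r = b *\<^sub>R u - a *\<^sub>R v"
  note F = linear_add[OF lin(1)] linear_diff[OF lin(1)] linear_scale[OF lin(1)]
  note G = linear_add[OF lin(2)] linear_diff[OF lin(2)] linear_scale[OF lin(2)]
  have "((norm (f p))\<^sup>2 - (norm (g p))\<^sup>2) - ((norm (f r))\<^sup>2 - (norm (g r))\<^sup>2)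
      = 4 * (a * b) * (f u \<bullet> f v - g u \<bullet> g v)"
    unfolding p_def r_def power2_norm_eq_inner F G
    by (simp add: inner_add_left inner_add_right inner_diff_left inner_diff_right inner_commute
        algebra_simps)
  \<comment> \<open>Parallelogram law; the scaling makes each summand on the right equal to
    \<open>2 * (a * b)\<^sup>2\<close>.\<close>
  moreover have "(norm (f p))\<^sup>2 + (norm (f r))\<^sup>2 = 2 * (b\<^sup>2 * (f u \<bullet> f u)) + 2 * (a\<^sup>2 * (f v \<bullet> f v))"
    unfolding p_def r_def power2_norm_eq_inner F
    by (simp add: inner_add_left inner_add_right inner_diff_left inner_diff_right inner_commute
        algebra_simps power2_eq_square)
  then have "(norm (f p))\<^sup>2 + (norm (f r))\<^sup>2 = 4 * (a * b) * (a * b)"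
    by (simp add: dot_square_norm a_def b_def power2_eq_square)
  \<comment> \<open>The lower embedding bound is applied to \<open>p\<close>, the upper one to
    \<open>r\<close>.\<close>
  moreover have "((norm (f p))\<^sup>2 - (norm (g p))\<^sup>2) - ((norm (f r))\<^sup>2 - (norm (g r))\<^sup>2)
      \<le> \<epsilon> * ((norm (f p))\<^sup>2 + (norm (f r))\<^sup>2)"
    using emb(1)[of p] emb(2)[of r] by (simp add: algebra_simps)
  ultimately have "4 * (a * b) * (f u \<bullet> f v - g u \<bullet> g v) \<le> 4 * (a * b) * (\<epsilon> * (a * b))"
    by (simp add: algebra_simps)
  then have "f u \<bullet> f v - g u \<bullet> g v \<le> \<epsilon> * (a * b)"
    using pos by simp
  then show ?thesis by (simp add: a_def b_def mult.assoc)
qed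

lemma sketched_critical_point_bound:
  fixes X :: "real^'d^'n" and Xt :: "real^'d^'m"
  assumes h: "strongly_convex \<sigma> h"
    and emb: "\<And>\<beta>. (1 - \<epsilon>) * (norm (X *v \<beta>))\<^sup>2 \<le> (norm (Xt *v \<beta>))\<^sup>2"
      "\<And>\<beta>. (norm (Xt *v \<beta>))\<^sup>2 \<le> (1 + \<epsilon>) * (norm (X *v \<beta>))\<^sup>2"
    and s: "critical_point (least_squares_objective X y h) \<beta>s"
    and t: "critical_point (sketched_objective Xt X y h) \<beta>t"
  shows "\<sigma> * (norm (\<beta>t - \<beta>s))\<^sup>2 + (1 - \<epsilon>) * (norm (X *v (\<beta>t - \<beta>s)))\<^sup>2
    \<le> \<epsilon> * norm (X *v \<beta>s) * norm (X *v (\<beta>t - \<beta>s))"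
proof -
  define D where "D = \<beta>t - \<beta>s"
  have tD: "\<beta>t = \<beta>s + D" by (simp add: D_def)
  \<comment> \<open>The term \<open>transpose X *v y\<close> cancels because the linear part is not
    sketched.\<close>
  have "gradient h \<beta>t - gradient h \<beta>s = transpose X *v (X *v \<beta>s) - transpose Xt *v (Xt *v \<beta>t)"
    using s t unfolding least_squares_objective_eq sketched_objective_eq
      critical_point_quadratic_plus_convex[OF h] by simp
  then have "\<sigma> * (norm D)\<^sup>2 \<le> (X *v \<beta>s) \<bullet> (X *v D) - (Xt *v \<beta>t) \<bullet> (Xt *v D)"
    using strongly_convex_gradient_monotone[OF h, of \<beta>t \<beta>s]
    by (simp add: D_def[symmetric] inner_diff_left dot_lmul_matrix)
  also have "\<dots> = (X *v \<beta>s) \<bullet> (X *v D) - (Xt *v \<beta>s) \<bullet> (Xt *v D) - (norm (Xt *v D))\<^sup>2"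
    by (simp add: tD matrix_vector_right_distrib inner_add_left power2_norm_eq_inner)
  also have "\<dots> \<le> \<epsilon> * norm (X *v \<beta>s) * norm (X *v D) - (1 - \<epsilon>) * (norm (X *v D))\<^sup>2"
    using embedding_inner_bound[of "(*v) X" "(*v) Xt" \<epsilon> \<beta>s D] emb by (intro diff_mono) auto
  finally show ?thesis by (simp add: D_def)
qed

text \<open>Here \<open>N\<close> stands for the squared Euclidean error, \<open>s\<close> for the
  error in the seminorm of \<open>X\<close>, and \<open>b\<close> for the seminorm of
  \<open>\<beta>s\<close>.\<close>

lemma quadratic_bound_consequences:
  fixes \<epsilon> \<sigma> b s N :: real
  assumes "0 < \<sigma>" "\<epsilon> < 1" and main: "\<sigma> * N + (1 - \<epsilon>) * s\<^sup>2 \<le> \<epsilon> * b * s"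
  shows "N \<le> \<epsilon>\<^sup>2 / (4 * \<sigma> * (1 - \<epsilon>)) * b\<^sup>2"
    and "0 < s \<Longrightarrow> s \<le> \<epsilon> / (1 - \<epsilon>) * b - \<sigma> * N / ((1 - \<epsilon>) * s)"
proof -
  \<comment> \<open>Completing the square:
    \<open>\<epsilon> * b * s - (1 - \<epsilon>) * s\<^sup>2\<close> is largest at
    \<open>s = \<epsilon> * b / (2 * (1 - \<epsilon>))\<close>, whence the factor 4.\<close>
  have "0 \<le> (2 * (1 - \<epsilon>) * s - \<epsilon> * b)\<^sup>2" by simp
  then have "4 * (1 - \<epsilon>) * (\<epsilon> * b * s - (1 - \<epsilon>) * s\<^sup>2) \<le> \<epsilon>\<^sup>2 * b\<^sup>2"
    by (simp add: power2_eq_square algebra_simps)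
  moreover have "4 * (1 - \<epsilon>) * (\<sigma> * N) \<le> 4 * (1 - \<epsilon>) * (\<epsilon> * b * s - (1 - \<epsilon>) * s\<^sup>2)"
    using assms by (intro mult_left_mono) auto
  ultimately have "N * (4 * \<sigma> * (1 - \<epsilon>)) \<le> \<epsilon>\<^sup>2 * b\<^sup>2" by (simp add: mult_ac)
  then show "N \<le> \<epsilon>\<^sup>2 / (4 * \<sigma> * (1 - \<epsilon>)) * b\<^sup>2"
    using assms by (simp add: pos_le_divide_eq)
  assume s: "0 < s"
  have "s * ((1 - \<epsilon>) * s) \<le> \<epsilon> * b * s - \<sigma> * N"
    using main by (simp add: power2_eq_square algebra_simps)
  then have "s \<le> (\<epsilon> * b * s - \<sigma> * N) / ((1 - \<epsilon>) * s)"
    using s assms by (simp add: pos_le_divide_eq)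
  also have "\<dots> = \<epsilon> / (1 - \<epsilon>) * b - \<sigma> * N / ((1 - \<epsilon>) * s)"
    using s by (simp add: diff_divide_distrib)
  finally show "s \<le> \<epsilon> / (1 - \<epsilon>) * b - \<sigma> * N / ((1 - \<epsilon>) * s)" .
qed

section \<open>Measurability of the event\<close>

text \<open>Projections of closed sets need not be closed, but those of compact sets are compact; so
  the open set is exhausted by compact sets first.\<close>

lemma borel_fst_image_closed_Int_open:
  fixes C U :: "('a::euclidean_space \<times> 'b::euclidean_space) set"
  assumes "closed C" "open U"
  shows "fst ` (C \<inter> U) \<in> sets borel"
proof -
  obtain K :: "nat \<Rightarrow> ('a \<times> 'b) set" where K: "\<And>n. compact (K n)" "(\<Union>n. K n) = U"
    by (rule open_Union_compact_subsets[OF \<open>open U\<close>]) (rule that)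
  have "fst ` (C \<inter> U) = (\<Union>n. fst ` (C \<inter> K n))" using K(2) by auto
  moreover have "fst ` (C \<inter> K n) \<in> sets borel" for n
    by (intro borel_closed compact_imp_closed compact_continuous_image continuous_on_fst
        continuous_on_id closed_Int_compact \<open>closed C\<close> K(1))
  ultimately show ?thesis by auto
qed

lemma continuous_on_matrix_vector_mult [continuous_intros]:
  fixes A :: "'a::topological_space \<Rightarrow> real^'n^'m"
  assumes "continuous_on S A" "continuous_on S x"
  shows "continuous_on S (\<lambda>z. A z *v x z)"
  unfolding matrix_vector_mult_def by (intro continuous_intros assms)

lemma sketched_critical_points_borel:
  fixes X :: "real^'d^'n" and h :: "real^'d \<Rightarrow> real"
  assumes h: "strongly_convex \<sigma> h" and "open U"
  shows "{P :: real^'n^'m. \<exists>\<beta>. critical_point (sketched_objective (P ** X) X y h) \<beta> \<and> \<beta> \<in> U}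
    \<in> sets borel"
proof -
  define q where "q P \<beta> = 1/2 * (norm (P *v (X *v \<beta>)))\<^sup>2 - (transpose X *v y) \<bullet> \<beta> + 0 + h \<beta>"
    for P :: "real^'n^'m" and \<beta>
  \<comment> \<open>Pairs of a matrix and a minimiser: for each \<open>z\<close> the condition is a
    non-strict inequality between continuous functions, so \<open>C\<close> is closed.\<close>
  define C :: "((real^'n^'m) \<times> (real^'d)) set"
    where "C = (\<Inter>z. {p. q (fst p) (snd p) \<le> q (fst p) z})"
  have crit: "critical_point (sketched_objective (P ** X) X y h) \<beta> \<longleftrightarrow> (P, \<beta>) \<in> C" for P :: "real^'n^'m" and \<beta>
    unfolding sketched_objective_eq critical_point_quadratic_plus_convex_iff_min[OF h]
    by (simp add: C_def q_def matrix_vector_mul_assoc[symmetric])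
  have "continuous_on UNIV (\<lambda>p :: (real^'n^'m) \<times> (real^'d). h (snd p))"
    by (rule continuous_on_compose2[OF strongly_convex_continuous_on[OF h, of UNIV]])
      (auto intro: continuous_intros)
  then have "closed C"
    unfolding C_def q_def by (intro closed_INT ballI closed_Collect_le continuous_intros) auto
  moreover have "open (UNIV \<times> U :: ((real^'n^'m) \<times> (real^'d)) set)"
    using assms by (intro open_Times) auto
  ultimately have "fst ` (C \<inter> UNIV \<times> U) \<in> sets borel"
    by (rule borel_fst_image_closed_Int_open)
  moreover have "fst ` (C \<inter> UNIV \<times> U)
      = {P. \<exists>\<beta>. critical_point (sketched_objective (P ** X) X y h) \<beta> \<and> \<beta> \<in> U}"
    unfolding crit by force
  ultimately show ?thesis by simp
qed

section \<open>The probability bound\<close>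

text \<open>Quantifying over all \<open>\<beta>t\<close> inside the event avoids selecting a
  critical point as a function of \<open>P\<close>.\<close>

theorem mainTheorem4:
  fixes X :: "real^'d^'n" and y :: "real^'n"
    and h :: "real^'d \<Rightarrow> real"
    and \<P> :: "(real^'n^'m) measure"
    and \<sigma> \<epsilon> \<epsilon>\<^sub>0 \<delta> :: real
    and \<beta>s :: "real^'d"
  assumes "0 < \<sigma>"
    and "strongly_convex \<sigma> h"
    and "0 < \<epsilon>" and "\<epsilon> < \<epsilon>\<^sub>0" and "\<epsilon>\<^sub>0 < 1"
    and "0 < \<delta>" and "\<delta> < 1"
    and "oblivious_subspace_embedding TYPE('d) \<epsilon> \<delta> \<P>"
    and "critical_point (least_squares_objective X y h) \<beta>s"
  shows "measure \<P> {P \<in> space \<P>. \<forall>\<beta>t.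
           critical_point (sketched_objective (P ** X) X y h) \<beta>t \<longrightarrow>
             (norm (\<beta>t - \<beta>s))\<^sup>2 \<le> \<epsilon>\<^sup>2 / (4 * \<sigma> * (1 - \<epsilon>)) * (mat_seminorm X \<beta>s)\<^sup>2 \<and>
             (mat_seminorm X (\<beta>t - \<beta>s) \<noteq> 0 \<longrightarrow>
                mat_seminorm X (\<beta>t - \<beta>s) \<le>
                  \<epsilon> / (1 - \<epsilon>) * mat_seminorm X \<beta>s
                  - \<sigma> * (norm (\<beta>t - \<beta>s))\<^sup>2 / ((1 - \<epsilon>) * mat_seminorm X (\<beta>t - \<beta>s)))}
         \<ge> 1 - \<delta>"
proof -
  let ?s = "\<lambda>\<beta>t. mat_seminorm X (\<beta>t - \<beta>s)"
  define R where "R \<beta>t \<longleftrightarrow>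
      (norm (\<beta>t - \<beta>s))\<^sup>2 \<le> \<epsilon>\<^sup>2 / (4 * \<sigma> * (1 - \<epsilon>)) * (mat_seminorm X \<beta>s)\<^sup>2 \<and>
      (?s \<beta>t \<noteq> 0 \<longrightarrow> ?s \<beta>t \<le> \<epsilon> / (1 - \<epsilon>) * mat_seminorm X \<beta>s
        - \<sigma> * (norm (\<beta>t - \<beta>s))\<^sup>2 / ((1 - \<epsilon>) * ?s \<beta>t))" for \<beta>t
  define T where "T = {P \<in> space \<P>. \<forall>\<beta>t.
      critical_point (sketched_objective (P ** X) X y h) \<beta>t \<longrightarrow> R \<beta>t}"
  define G where "G = {P \<in> space \<P>. \<forall>\<beta>.
      (1 - \<epsilon>) * (norm (X *v \<beta>))\<^sup>2 \<le> (norm ((P ** X) *v \<beta>))\<^sup>2 \<and>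
      (norm ((P ** X) *v \<beta>))\<^sup>2 \<le> (1 + \<epsilon>) * (norm (X *v \<beta>))\<^sup>2}"
  have \<epsilon>: "\<epsilon> < 1" using assms by simp
  have P: "prob_space \<P>" "sets \<P> = sets borel" and G: "1 - \<delta> \<le> measure \<P> G"
    using \<open>oblivious_subspace_embedding TYPE('d) \<epsilon> \<delta> \<P>\<close>
    unfolding oblivious_subspace_embedding_def G_def by auto
  interpret prob_space \<P> by fact

  \<comment> \<open>Multiplying the second bound by ?s removes the division, which is discontinuous at ?s = 0.\<close>
  have R_iff: "R \<beta>t \<longleftrightarrow>
      (norm (\<beta>t - \<beta>s))\<^sup>2 \<le> \<epsilon>\<^sup>2 / (4 * \<sigma> * (1 - \<epsilon>)) * (mat_seminorm X \<beta>s)\<^sup>2 \<and>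
      (?s \<beta>t \<noteq> 0 \<longrightarrow> (1 - \<epsilon>) * (?s \<beta>t)\<^sup>2
        \<le> \<epsilon> * mat_seminorm X \<beta>s * ?s \<beta>t - \<sigma> * (norm (\<beta>t - \<beta>s))\<^sup>2)" for \<beta>t
  proof -
    have "s \<le> \<epsilon> / (1 - \<epsilon>) * b - \<sigma> * N / ((1 - \<epsilon>) * s) \<longleftrightarrow> (1 - \<epsilon>) * s\<^sup>2 \<le> \<epsilon> * b * s - \<sigma> * N"
      if "0 < s" for s b N :: real
    proof -
      have "\<epsilon> / (1 - \<epsilon>) * b - \<sigma> * N / ((1 - \<epsilon>) * s) = (\<epsilon> * b * s - \<sigma> * N) / ((1 - \<epsilon>) * s)"
        using that by (simp add: diff_divide_distrib)
      then show ?thesis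
        using that \<epsilon> by (simp add: pos_le_divide_eq power2_eq_square mult_ac)
    qed
    moreover have "0 \<le> ?s \<beta>t" by (simp add: mat_seminorm_def)
    ultimately show ?thesis unfolding R_def by (metis order_less_le)
  qed
  \<comment> \<open>Negation yields only strict inequalities and a disequality between continuous
    functions, hence an open set.\<close>
  have nR: "{\<beta>. \<not> R \<beta>} =
      {\<beta>. \<epsilon>\<^sup>2 / (4 * \<sigma> * (1 - \<epsilon>)) * (mat_seminorm X \<beta>s)\<^sup>2 < (norm (\<beta> - \<beta>s))\<^sup>2} \<union>
      ({\<beta>. ?s \<beta> \<noteq> 0} \<inter> {\<beta>. \<epsilon> * mat_seminorm X \<beta>s * ?s \<beta> - \<sigma> * (norm (\<beta> - \<beta>s))\<^sup>2
        < (1 - \<epsilon>) * (?s \<beta>)\<^sup>2})"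
    unfolding R_iff not_le[symmetric] by blast
  have "open {\<beta>. \<not> R \<beta>}"
    unfolding nR mat_seminorm_def
    by (intro open_Un open_Int open_Collect_less open_Collect_neq continuous_intros)
  \<comment> \<open>\<open>T\<close> is the complement of the set of matrices for which some
    critical point violates \<open>R\<close>.\<close>
  from sketched_critical_points_borel[OF \<open>strongly_convex \<sigma> h\<close> this, of X y]
  have "space \<P> - {P. \<exists>\<beta>. critical_point (sketched_objective (P ** X) X y h) \<beta> \<and> \<beta> \<in> {\<beta>. \<not> R \<beta>}}
      \<in> sets \<P>"
    by (intro sets.compl_sets) (simp only: P(2))
  also have "space \<P> - {P. \<exists>\<beta>. critical_point (sketched_objective (P ** X) X y h) \<beta> \<and> \<beta> \<in> {\<beta>. \<not> R \<beta>}}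
      = T"
    by (auto simp: T_def)
  finally have T: "T \<in> sets \<P>" .
  have "G \<subseteq> T"
  proof
    fix P assume "P \<in> G"
    then have emb: "(1 - \<epsilon>) * (norm (X *v \<beta>))\<^sup>2 \<le> (norm ((P ** X) *v \<beta>))\<^sup>2"
      "(norm ((P ** X) *v \<beta>))\<^sup>2 \<le> (1 + \<epsilon>) * (norm (X *v \<beta>))\<^sup>2" for \<beta>
      by (auto simp: G_def)
    have "R \<beta>t" if "critical_point (sketched_objective (P ** X) X y h) \<beta>t" for \<beta>t
    proof -
      note b = sketched_critical_point_bound[OF \<open>strongly_convex \<sigma> h\<close> emb
          \<open>critical_point (least_squares_objective X y h) \<beta>s\<close> that, folded mat_seminorm_def]
      have "?s \<beta>t \<noteq> 0 \<Longrightarrow> 0 < ?s \<beta>t" by (simp add: mat_seminorm_def)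
      then show ?thesis
        unfolding R_def using quadratic_bound_consequences[OF \<open>0 < \<sigma>\<close> \<epsilon> b] by blast
    qed
    with \<open>P \<in> G\<close> show "P \<in> T" by (simp add: T_def G_def)
  qed
  \<comment> \<open>Monotonicity of the measure requires the larger set \<open>T\<close> to be
    measurable.\<close>
  then have "measure \<P> G \<le> measure \<P> T" using T by (rule finite_measure_mono)
  with G show ?thesis unfolding T_def R_def by linarith
qed

end
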